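(* Consider the linear model $y = X\beta^* + \varepsilon$ with $\beta^* = 0$, i.e. $y = \varepsilon$, where $\varepsilon$ has entries that are independent random variables with zero mean and finite variance. Suppose that $X$ has the self-regularizing property with constant $\tau > 0$ (see context). Then $$\min_{\beta \succeq 0} \frac{1}{n}\|\varepsilon - X\beta\|_2^2 = \min_{\beta \succeq 0}\left\{ \frac{1}{n}\|\varepsilon - \widetilde{X}\beta\|_2^2 + \tau^2 (\mathbf{1}^\top\beta)^2 \right\} + O_{\mathbf{P}}\left(\frac{1}{\sqrt{n}}\right),$$ with $\widetilde{X} = (\Pi X) D$, where $\Pi$ is a projection onto an $(n-1)$-dimensional subspace of $\mathbb{R}^n$ and $D$ is a diagonal matrix whose diagonal entries are contained in $[\tau, 1]$. Moreover, if $\frac{1}{n}\|X^\top\varepsilon\|_\infty = o_{\mathbf{P}}(1)$, then any minimizer $\widehat{\beta}$ of the problem $\min_{\beta \succeq 0} \frac{1}{n}\|\varepsilon - X\beta\|_2^2$ on the left-hand side obeys $\frac{1}{n}\|X\widehat{\beta}\|_2^2 = o_{\mathbf{P}}(1)$.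
   Context: $X \in \mathbb{R}^{n\times p}$ is a deterministic design matrix with columns $X_1,\dots,X_p$ normalized such that $\|X_j\|_2^2 = n$ for $j=1,\dots,p$. The symbol $\succeq$ denotes componentwise inequality, and $\mathbf{1}$ is the vector of ones. Asymptotics are as $n\to\infty$, for a triangular array $X = X_n \in \mathbb{R}^{n\times p_n}$, $y = y_n$, with $p = p_n$ depending on $n$. Define $$\tau_0 = \max\left\{\tau : \exists w\in\mathbb{R}^n,\ \|w\|_2\le 1,\ \text{such that } \frac{X^\top w}{\sqrt{n}} \succeq \tau\mathbf{1}\right\}.$$ The design $X$ has the self-regularizing property with constant $\tau$ if $\tau>0$ is a constant (not depending on $n$) such that $\tau_0 \ge \tau > 0$.
   Formalization: "Finite variance" is read as: the variances of all entries of ε are bounded by one constant σ² not depending on n; with variances growing in n the O_P(1/√n) claim fails (e.g. p=1, X the vector of ones, τ=1). *)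

theory Defs
  imports "HOL-Probability.Probability" "Jordan_Normal_Form.DL_Rank"
begin

unbundle no vec_syntax

definition l2_norm :: "real vec \<Rightarrow> real" where
  "l2_norm v = L2_set (vec_index v) {..<dim_vec v}"

text \<open>Only meaningful for vectors of positive dimension.\<close>

definition linf_norm :: "real vec \<Rightarrow> real" where
  "linf_norm v = Max ((\<lambda>j. \<bar>v $ j\<bar>) ` {..<dim_vec v})"

definition ones_vec :: "nat \<Rightarrow> real vec" where
  "ones_vec p = vec p (\<lambda>_. 1)"

text \<open>The order on vectors is componentwise, and comparable vectors have equal dimension.  In
  particular, membership in the nonnegative orthant fixes the dimension.\<close>

definition nonneg_orthant :: "nat \<Rightarrow> real vec set" where
  "nonneg_orthant p = {\<beta>. 0\<^sub>v p \<le> \<beta>}"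

text \<open>The minimum as an attained value; it is unspecified if there is no minimizer.\<close>

definition min_over :: "'b set \<Rightarrow> ('b \<Rightarrow> real) \<Rightarrow> real" where
  "min_over S f = (LEAST v. v \<in> f ` S)"

text \<open>For \<open>X \<in> \<real>\<^sup>n\<^sup>\<times>\<^sup>p\<close>.  The maximum exists whenever \<open>n, p \<ge> 1\<close>.\<close>

definition tau0 :: "real mat \<Rightarrow> real" where
  "tau0 X = (GREATEST \<tau>. \<exists>w \<in> carrier_vec (dim_row X). l2_norm w \<le> 1 \<and>
     \<tau> \<cdot>\<^sub>v ones_vec (dim_col X) \<le>
       (1 / sqrt (real (dim_row X))) \<cdot>\<^sub>v (transpose_mat X *\<^sub>v w))"

text \<open>The constant is the same for all designs \<open>X n\<close> (with \<open>n\<close> rows) of the triangular array.\<close>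

definition self_regularizing :: "(nat \<Rightarrow> real mat) \<Rightarrow> real \<Rightarrow> bool" where
  "self_regularizing X \<tau> \<longleftrightarrow> \<tau> > 0 \<and> (\<forall>n\<ge>1. tau0 (X n) \<ge> \<tau>)"

definition nnls_objective :: "real mat \<Rightarrow> real vec \<Rightarrow> real vec \<Rightarrow> real" where
  "nnls_objective X y \<beta> = (1 / real (dim_row X)) * (l2_norm (y - X *\<^sub>v \<beta>))\<^sup>2"

text \<open>Matrix of the orthogonal projection of \<open>\<real>\<^sup>n\<close> onto a subspace of dimension \<open>d\<close>: a symmetric
  idempotent matrix whose column space has dimension \<open>d\<close>.\<close>

definition orthogonal_projection :: "nat \<Rightarrow> nat \<Rightarrow> real mat \<Rightarrow> bool" where
  "orthogonal_projection n d P \<longleftrightarrow> P \<in> carrier_mat n n \<and> P * P = P \<and> transpose_mat P = P \<and>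
     vec_space.rank n P = d"

text \<open>Stochastic order symbols, for variables \<open>Z n\<close> on probability spaces \<open>M n\<close> which may differ
  for each \<open>n\<close>.  Outer probabilities agree with probabilities on measurable events; they are used so
  that the statements keep their meaning when the measurability of \<open>Z n\<close> is not known, e.g. for an
  arbitrary choice of minimizers.\<close>

definition bigO_P :: "(nat \<Rightarrow> 'a measure) \<Rightarrow> (nat \<Rightarrow> 'a \<Rightarrow> real) \<Rightarrow> (nat \<Rightarrow> real) \<Rightarrow> bool" where
  "bigO_P M Z a \<longleftrightarrow> (\<forall>\<delta>>0. \<exists>C. \<forall>\<^sub>F n in sequentially.
     outer_measure_of (M n) {\<omega> \<in> space (M n). \<bar>Z n \<omega>\<bar> > C * a n} < ennreal \<delta>)"

definition smallo_P :: "(nat \<Rightarrow> 'a measure) \<Rightarrow> (nat \<Rightarrow> 'a \<Rightarrow> real) \<Rightarrow> (nat \<Rightarrow> real) \<Rightarrow> bool" where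
  "smallo_P M Z a \<longleftrightarrow> (\<forall>c>0.
     (\<lambda>n. outer_measure_of (M n) {\<omega> \<in> space (M n). \<bar>Z n \<omega>\<bar> > c * a n}) \<longlonglongrightarrow> 0)"

end

theory Submission
  imports Defs
begin

text \<open>
  Let \<open>w\<close> attain \<open>\<tau>\<^sub>0\<close>, rescaled to unit length, and let \<open>a\<^sub>j = X\<^sub>j\<^sup>T w / \<surd>n\<close>, so that
  \<open>a\<^sub>j \<in> [\<tau>, 1]\<close>.  Take \<open>\<Pi>\<close> to be the projection along \<open>w\<close> and \<open>D\<^sub>j\<^sub>j = \<tau> / a\<^sub>j\<close>, a bijection of the
  nonnegative orthant.  Splitting residuals along \<open>w\<close>, the regularized objective at \<open>\<gamma>\<close> exceeds the
  original one at \<open>\<beta> = D \<gamma>\<close> by exactly \<open>2 (w\<^sup>T X \<beta>) (w\<^sup>T \<epsilon>) / n\<close>.  At minimizers \<open>w\<^sup>T X \<beta>\<close> is at most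
  twice the norm of \<open>\<epsilon>\<close> (comparison with \<open>\<beta> = 0\<close>), so \<open>\<surd>n\<close> times the difference of the minima is
  dominated by a variable of expectation at most \<open>4 \<sigma>\<^sup>2\<close>, and Markov's inequality applies.

  For the second claim, optimality against \<open>\<beta> = 0\<close> and the bound of \<open>\<tau> \<surd>n (1\<^sup>T \<beta>)\<close> by \<open>w\<^sup>T X \<beta>\<close>, hence
  by the norm of \<open>X \<beta>\<close>, show that the prediction error is at most the square of
  \<open>2 / \<tau>\<close> times the maximum norm of \<open>X\<^sup>T \<epsilon> / n\<close>.
\<close>

unbundle no inner_syntax

section \<open>Norms, inner products and the nonnegative orthant\<close>

lemma l2_norm_nonneg: "0 \<le> l2_norm v"
  by (simp add: l2_norm_def)

lemma l2_norm_power2: "(l2_norm v)\<^sup>2 = v \<bullet> v"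
  by (simp add: l2_norm_def L2_set_def sum_nonneg scalar_prod_def power2_eq_square
      atLeast0LessThan)

lemma scalar_prod_self_nonneg: "0 \<le> v \<bullet> v" for v :: "real vec"
  by (simp flip: l2_norm_power2)

lemma abs_scalar_prod_le_l2_norm:
  assumes "dim_vec v = dim_vec w"
  shows "\<bar>v \<bullet> w\<bar> \<le> l2_norm v * l2_norm w"
proof -
  have "\<bar>v \<bullet> w\<bar> \<le> (\<Sum>i<dim_vec w. \<bar>v $ i\<bar> * \<bar>w $ i\<bar>)"
    unfolding scalar_prod_def atLeast0LessThan
    by (rule order_trans[OF sum_abs]) (simp add: abs_mult)
  also have "\<dots> \<le> l2_norm v * l2_norm w"
    unfolding l2_norm_def assms by (rule L2_set_mult_ineq)
  finally show ?thesis .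
qed

lemma nonneg_orthant_iff:
  "\<beta> \<in> nonneg_orthant p \<longleftrightarrow> \<beta> \<in> carrier_vec p \<and> (\<forall>j<p. 0 \<le> \<beta> $ j)"
  by (auto simp: nonneg_orthant_def less_eq_vec_def)

lemma zero_in_nonneg_orthant: "0\<^sub>v p \<in> nonneg_orthant p"
  by (simp add: nonneg_orthant_iff)

lemma ones_vec_scalar_prod:
  assumes "\<beta> \<in> carrier_vec p"
  shows "ones_vec p \<bullet> \<beta> = (\<Sum>j<p. \<beta> $ j)"
  using assms by (simp add: ones_vec_def scalar_prod_def atLeast0LessThan)

text \<open>Hoelder's inequality for the pair of maximum and sum norms; on the orthant the sum norm
  of \<open>\<beta>\<close> is the plain sum of its coordinates.\<close>

lemma scalar_prod_le_linf_norm: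
  assumes "v \<in> carrier_vec p" "\<beta> \<in> nonneg_orthant p"
  shows "v \<bullet> \<beta> \<le> linf_norm v * (\<Sum>j<p. \<beta> $ j)"
proof -
  have "v $ j \<le> linf_norm v" if "j < p" for j
  proof -
    have "\<bar>v $ j\<bar> \<le> linf_norm v"
      unfolding linf_norm_def using assms that by (intro Max_ge) auto
    then show ?thesis by linarith
  qed
  then show ?thesis
    using assms
    by (auto simp: scalar_prod_def atLeast0LessThan nonneg_orthant_iff sum_distrib_left
        intro!: sum_mono mult_right_mono)
qed

section \<open>Attained minima over the nonnegative orthant\<close>

lemma min_over_eq:
  assumes "x \<in> S" "\<And>y. y \<in> S \<Longrightarrow> f x \<le> f y"
  shows "min_over S f = f x"
  unfolding min_over_def using assms by (intro Least_equality) auto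

text \<open>Tychonoff's theorem, read through the fact that the topology on functions is the product
  topology.\<close>

lemma compact_PiE_UNIV:
  fixes S :: "'i \<Rightarrow> 'b :: topological_space set"
  assumes "\<And>i. compact (S i)"
  shows "compact (PiE UNIV S)"
  using compactin_PiE[of "\<lambda>_. euclidean" UNIV S] assms
  by (simp add: euclidean_product_topology)

text \<open>Compactness is used on functions \<open>nat \<Rightarrow> real\<close>, which
  \<open>vec p\<close> carries over to vectors. The hypothesis \<open>bound\<close> puts every point
  of the orthant that is at least as good as zero into a box, so a minimum over the box beats these
  points directly and all others by comparison with zero.\<close>

lemma nonneg_orthant_attains_min:
  fixes F :: "real vec \<Rightarrow> real"
  assumes cont: "continuous_on UNIV (\<lambda>x. F (vec p x))"
    and bound: "\<And>\<beta> j. \<lbrakk>\<beta> \<in> nonneg_orthant p; F \<beta> \<le> F (0\<^sub>v p); j < p\<rbrakk> \<Longrightarrow> \<beta> $ j \<le> B"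
  obtains \<beta> where "\<beta> \<in> nonneg_orthant p" "\<And>\<gamma>. \<gamma> \<in> nonneg_orthant p \<Longrightarrow> F \<beta> \<le> F \<gamma>"
proof -
  \<comment> \<open>Coordinates from \<open>p\<close> on are pinned to zero: this keeps the product
    over all indices compact, and \<open>vec p\<close> ignores them.\<close>
  define K where "K = PiE UNIV (\<lambda>i. if i < p then {0..B} else {0::real})"
  have repr: "\<exists>x\<in>K. vec p x = \<gamma>" if "\<gamma> \<in> nonneg_orthant p" "F \<gamma> \<le> F (0\<^sub>v p)" for \<gamma>
    using that bound[OF that]
    by (intro bexI[of _ "\<lambda>i. if i < p then \<gamma> $ i else 0"])
      (auto simp: K_def nonneg_orthant_iff)
  obtain x0 where x0: "x0 \<in> K" "vec p x0 = 0\<^sub>v p"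
    using repr zero_in_nonneg_orthant by blast
  have "compact K"
    unfolding K_def by (rule compact_PiE_UNIV) auto
  then obtain x where x: "x \<in> K" "\<And>y. y \<in> K \<Longrightarrow> F (vec p x) \<le> F (vec p y)"
    using continuous_attains_inf[of K "\<lambda>x. F (vec p x)"] x0(1) cont continuous_on_subset
    by (metis empty_iff subset_UNIV)
  show ?thesis
  proof
    show "vec p x \<in> nonneg_orthant p"
      using x(1) by (auto simp: K_def nonneg_orthant_iff PiE_def Pi_def split: if_splits)
    show "F (vec p x) \<le> F \<gamma>" if "\<gamma> \<in> nonneg_orthant p" for \<gamma>
    proof (cases "F \<gamma> \<le> F (0\<^sub>v p)")
      case True
      then show ?thesis using repr[OF that] x(2) by blast
    next
      case False
      then show ?thesis using x(2)[OF x0(1)] x0(2) by simp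
    qed
  qed
qed

section \<open>The value \<open>tau0\<close> and a unit vector realizing the constant\<close>

lemma continuous_on_Min_image:
  fixes f :: "'j \<Rightarrow> 'a :: topological_space \<Rightarrow> 'b :: linorder_topology"
  assumes "finite J" "J \<noteq> {}" "\<And>j. j \<in> J \<Longrightarrow> continuous_on S (f j)"
  shows "continuous_on S (\<lambda>x. Min ((\<lambda>j. f j x) ` J))"
  using assms by (induction rule: finite_ne_induct) (auto intro!: continuous_on_min)

text \<open>For fixed \<open>w\<close> the largest feasible \<open>\<tau>\<close> is the smallest
  scaled inner product of \<open>w\<close> with a column, called \<open>G w\<close>. Hence
  \<open>tau0\<close> is the maximum of the continuous function \<open>G\<close> over the unit ball,
  which exists by compactness, and the \<open>GREATEST\<close> in its definition is a true
  maximum.\<close>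

lemma tau0_attained:
  assumes X: "X \<in> carrier_mat n p" and p: "p \<ge> 1"
  obtains w where "w \<in> carrier_vec n" "l2_norm w \<le> 1"
    "\<And>j. j < p \<Longrightarrow> tau0 X \<le> (col X j \<bullet> w) / sqrt (real n)"
proof -
  define G where "G w = Min ((\<lambda>j. (col X j \<bullet> w) / sqrt (real n)) ` {..<p})" for w
  \<comment> \<open>The box is already implied by the norm bound for the first \<open>n\<close>
    coordinates; it presents \<open>K\<close> as a closed part of a compact product.\<close>
  define K where
    "K = PiE UNIV (\<lambda>i. if i < n then {-1..1} else {0::real}) \<inter> {x. (\<Sum>i<n. (x i)\<^sup>2) \<le> 1}"
  have [simp]: "dim_row X = n" "dim_col X = p" using X by auto
  have feas: "(\<tau> \<cdot>\<^sub>v ones_vec (dim_col X) \<le>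
       (1 / sqrt (real (dim_row X))) \<cdot>\<^sub>v (transpose_mat X *\<^sub>v w)) \<longleftrightarrow> \<tau> \<le> G w" for \<tau> w
    using p X by (auto simp: less_eq_vec_def ones_vec_def G_def lessThan_empty_iff)
  have coord: "continuous_on UNIV (\<lambda>x :: nat \<Rightarrow> real. x i)" for i
    by simp
  have cont: "continuous_on UNIV (\<lambda>x. G (vec n x))"
    unfolding G_def using p
    by (intro continuous_on_Min_image)
      (auto simp: scalar_prod_def lessThan_empty_iff divide_inverse
        intro!: continuous_intros coord)
  have norm_le: "l2_norm v \<le> 1 \<longleftrightarrow> (\<Sum>i<n. (v $ i)\<^sup>2) \<le> 1" if "v \<in> carrier_vec n" for v
    using that by (simp add: l2_norm_def L2_set_def)
  have "compact K"
    unfolding K_def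
    by (intro compact_Int_closed compact_PiE_UNIV closed_Collect_le continuous_intros coord) auto
  moreover have "(\<lambda>_. 0) \<in> K"
    by (auto simp: K_def)
  ultimately obtain x where x: "x \<in> K" "\<And>y. y \<in> K \<Longrightarrow> G (vec n y) \<le> G (vec n x)"
    using continuous_attains_sup[of K "\<lambda>x. G (vec n x)"] cont continuous_on_subset
    by (metis empty_iff subset_UNIV)
  have x_norm: "l2_norm (vec n x) \<le> 1"
    using x(1) by (simp add: norm_le K_def)
  have best: "G v \<le> G (vec n x)" if v: "v \<in> carrier_vec n" "l2_norm v \<le> 1" for v
  proof -
    let ?y = "\<lambda>i. if i < n then v $ i else 0"
    have sum_le: "(\<Sum>i<n. (v $ i)\<^sup>2) \<le> 1" using v norm_le by blast
    have "\<bar>v $ i\<bar> \<le> 1" if "i < n" for i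
    proof -
      have "(v $ i)\<^sup>2 \<le> (\<Sum>i<n. (v $ i)\<^sup>2)"
        using that by (intro member_le_sum) auto
      with sum_le have "(v $ i)\<^sup>2 \<le> 1" by linarith
      then show ?thesis by (simp add: abs_square_le_1)
    qed
    then have "?y \<in> K"
      using sum_le by (auto simp: K_def abs_le_iff minus_le_iff)
    moreover have "vec n ?y = v" using v(1) by auto
    ultimately show ?thesis using x(2) by metis
  qed
  have tau0: "tau0 X = G (vec n x)"
    unfolding tau0_def feas
    by (rule Greatest_equality) (use x_norm best in \<open>auto intro: order_trans\<close>)
  show ?thesis
  proof
    show "vec n x \<in> carrier_vec n" by simp
    show "l2_norm (vec n x) \<le> 1" by (rule x_norm)
    show "tau0 X \<le> (col X j \<bullet> vec n x) / sqrt (real n)" if "j < p" for j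
      unfolding tau0 G_def using that by (intro Min_le) auto
  qed
qed

text \<open>All inner products of the maximizing \<open>w\<close> with the columns are positive, so
  stretching \<open>w\<close> from norm at most one to norm one can only increase them.\<close>

lemma self_regularizing_direction:
  assumes X: "X \<in> carrier_mat n p" and np: "n \<ge> 1" "p \<ge> 1" and \<tau>: "0 < \<tau>" "\<tau> \<le> tau0 X"
  obtains w where "w \<in> carrier_vec n" "w \<bullet> w = 1"
    "\<And>j. j < p \<Longrightarrow> \<tau> * sqrt (real n) \<le> col X j \<bullet> w"
proof -
  obtain w where w: "w \<in> carrier_vec n" "l2_norm w \<le> 1"
    and tw: "\<And>j. j < p \<Longrightarrow> tau0 X \<le> (col X j \<bullet> w) / sqrt (real n)"
    using tau0_attained[OF X np(2)] by blast
  have ge: "\<tau> * sqrt (real n) \<le> col X j \<bullet> w" if "j < p" for j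
  proof -
    have "\<tau> \<le> (col X j \<bullet> w) / sqrt (real n)" using tw[OF that] \<tau> by linarith
    then show ?thesis using np by (simp add: field_simps)
  qed
  have pos: "0 < col X j \<bullet> w" if "j < p" for j
  proof -
    have "0 < \<tau> * sqrt (real n)" using \<tau> np by simp
    then show ?thesis using ge[OF that] by linarith
  qed
  define r where "r = l2_norm w"
  \<comment> \<open>Column \<open>0\<close> exists because \<open>p \<ge> 1\<close>; by
    Cauchy-Schwarz its inner product with a vector of norm zero would vanish.\<close>
  have "r \<noteq> 0"
  proof
    assume "r = 0"
    then have "\<bar>col X 0 \<bullet> w\<bar> \<le> 0"
      using abs_scalar_prod_le_l2_norm[of "col X 0" w] w X by (simp add: r_def)
    then show False using pos[of 0] np by simp
  qed
  then have r: "0 < r" "r \<le> 1" using l2_norm_nonneg[of w] w by (auto simp: r_def)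
  show ?thesis
  proof
    show "(1 / r) \<cdot>\<^sub>v w \<in> carrier_vec n" using w by simp
    show "((1 / r) \<cdot>\<^sub>v w) \<bullet> ((1 / r) \<cdot>\<^sub>v w) = 1"
    proof -
      have "w \<bullet> w = r * r"
        by (simp add: r_def power2_eq_square flip: l2_norm_power2)
      then show ?thesis using w r by simp
    qed
    show "\<tau> * sqrt (real n) \<le> col X j \<bullet> ((1 / r) \<cdot>\<^sub>v w)" if "j < p" for j
    proof -
      have "\<tau> * sqrt (real n) \<le> (col X j \<bullet> w) * 1" using ge[OF that] by simp
      also have "\<dots> \<le> (col X j \<bullet> w) * (1 / r)"
        using r pos[OF that] by (intro mult_left_mono) auto
      finally show ?thesis using w X that by (simp add: mult.commute)
    qed
  qed
qed

text \<open>In coordinates the objective is a polynomial.\<close>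

lemma continuous_on_nnls_objective:
  assumes "y \<in> carrier_vec m" "A \<in> carrier_mat m q"
  shows "continuous_on UNIV (\<lambda>x. nnls_objective A y (vec q x))"
proof -
  have coord: "continuous_on UNIV (\<lambda>x :: nat \<Rightarrow> real. x i)" for i
    by simp
  have "nnls_objective A y (vec q x) =
      (1 / real m) * (\<Sum>i<m. (y $ i - (\<Sum>j<q. A $$ (i, j) * x j))\<^sup>2)" for x
    using assms
    by (auto simp: nnls_objective_def l2_norm_def L2_set_def sum_nonneg scalar_prod_def
        atLeast0LessThan)
  then show ?thesis
    by (simp only:) (intro continuous_intros coord)
qed

section \<open>Deterministic analysis of one design with a fixed unit direction
  \<open>w\<close>\<close>

locale self_regularizing_design =
  fixes n p :: nat and X :: "real mat" and w :: "real vec" and \<tau> :: real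
  assumes n_pos: "n \<ge> 1"
    and X_carrier: "X \<in> carrier_mat n p"
    and X_normalized: "\<And>j. j < p \<Longrightarrow> (l2_norm (col X j))\<^sup>2 = real n"
    and w_carrier: "w \<in> carrier_vec n"
    and w_unit: "w \<bullet> w = 1"
    and \<tau>_pos: "0 < \<tau>"
    and col_ge: "\<And>j. j < p \<Longrightarrow> \<tau> * sqrt (real n) \<le> col X j \<bullet> w"
begin

definition a :: "nat \<Rightarrow> real" where
  "a j = (col X j \<bullet> w) / sqrt (real n)"

text \<open>This is I - w w^T, the orthogonal projection onto the complement of the unit vector
  \<open>w\<close>.\<close>

definition P :: "real mat" where
  "P = 1\<^sub>m n + mat n n (\<lambda>(i, j). - (w $ i) * w $ j)"

text \<open>The scaling gives all columns of \<open>X * D\<close> the same component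
  \<open>\<tau> * sqrt (real n)\<close> along \<open>w\<close>.\<close>

definition D :: "real mat" where
  "D = mat p p (\<lambda>(i, j). if i = j then \<tau> / a j else 0)"

definition s :: "real vec \<Rightarrow> real" where
  "s \<beta> = w \<bullet> (X *\<^sub>v \<beta>)"

lemma w_norm: "l2_norm w = 1"
  using l2_norm_power2[of w] l2_norm_nonneg[of w] by (simp add: w_unit power2_eq_1_iff)

lemma abs_w_scalar_prod_le: "v \<in> carrier_vec n \<Longrightarrow> \<bar>w \<bullet> v\<bar> \<le> l2_norm v"
  using abs_scalar_prod_le_l2_norm[of w v] w_carrier by (simp add: w_norm)

text \<open>The lower bound is the choice of \<open>w\<close>; the upper bound is Cauchy-Schwarz,
  since the columns have norm \<open>sqrt (real n)\<close> and \<open>w\<close> has norm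
  one.\<close>

lemma a_bounds:
  assumes "j < p"
  shows "\<tau> \<le> a j" "a j \<le> 1"
proof -
  have col: "col X j \<in> carrier_vec n" using X_carrier assms by auto
  show "\<tau> \<le> a j"
    using col_ge[OF assms] n_pos by (simp add: a_def field_simps)
  have "l2_norm (col X j) = sqrt (real n)"
    using X_normalized[OF assms] l2_norm_nonneg by (metis real_sqrt_unique)
  then have "col X j \<bullet> w \<le> sqrt (real n)"
    using abs_scalar_prod_le_l2_norm[of "col X j" w] carrier_vecD[OF col] carrier_vecD[OF w_carrier]
    by (simp add: w_norm)
  then show "a j \<le> 1" using n_pos by (simp add: a_def)
qed

lemma a_pos: "j < p \<Longrightarrow> 0 < a j"
  using a_bounds(1) \<tau>_pos by fastforce

lemma P_carrier: "P \<in> carrier_mat n n"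
  by (simp add: P_def)

lemma D_carrier: "D \<in> carrier_mat p p"
  by (simp add: D_def)

lemma D_diagonal: "diagonal_mat D"
  by (simp add: D_def diagonal_mat_def)

lemma D_entries: "j < p \<Longrightarrow> D $$ (j, j) \<in> {\<tau>..1}"
  using a_bounds[of j] a_pos[of j] \<tau>_pos by (simp add: D_def field_simps)

lemma P_mult_vec:
  assumes "v \<in> carrier_vec n"
  shows "P *\<^sub>v v = v - (w \<bullet> v) \<cdot>\<^sub>v w"
proof (rule eq_vecI)
  fix i assume "i < dim_vec (v - (w \<bullet> v) \<cdot>\<^sub>v w)"
  then have i: "i < n" using w_carrier by simp
  have "(P *\<^sub>v v) $ i = (\<Sum>j<n. ((if i = j then 1 else 0) - w $ i * w $ j) * v $ j)"
    using assms i by (auto simp: P_def scalar_prod_def atLeast0LessThan intro!: sum.cong)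
  also have "\<dots> = (\<Sum>j<n. (if i = j then v $ j else 0) - w $ i * (w $ j * v $ j))"
    by (intro sum.cong) (auto simp: algebra_simps)
  also have "\<dots> = v $ i - w $ i * (\<Sum>j<n. w $ j * v $ j)"
    using i by (simp add: sum_subtractf sum_distrib_left)
  also have "\<dots> = (v - (w \<bullet> v) \<cdot>\<^sub>v w) $ i"
    using i assms w_carrier by (simp add: scalar_prod_def atLeast0LessThan)
  finally show "(P *\<^sub>v v) $ i = (v - (w \<bullet> v) \<cdot>\<^sub>v w) $ i" .
qed (use assms w_carrier P_carrier in auto)

lemma P_mult_w: "P *\<^sub>v w = 0\<^sub>v n"
  using P_mult_vec[OF w_carrier] w_carrier by (simp add: w_unit)

text \<open>Each column of \<open>P\<close> is orthogonal to \<open>w\<close>, and \<open>P\<close>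
  fixes every vector orthogonal to \<open>w\<close>.\<close>

lemma P_idempotent: "P * P = P"
proof (rule eq_matI)
  fix i j assume "i < dim_row P" "j < dim_col P"
  then have ij: "i < n" "j < n" using P_carrier by auto
  have c: "col P j \<in> carrier_vec n" using P_carrier by (intro carrier_vecI) simp
  have colP: "col P j = unit_vec n j - w $ j \<cdot>\<^sub>v w"
    using ij w_carrier by (intro eq_vecI) (auto simp: P_def)
  have "w \<bullet> col P j = 0"
    unfolding colP using ij w_carrier
    by (simp add: scalar_prod_minus_distrib[of _ n] w_unit scalar_prod_right_unit)
  then have "P *\<^sub>v col P j = col P j"
    using P_mult_vec[OF c] carrier_vecD[OF c] carrier_vecD[OF w_carrier] by (intro eq_vecI) auto
  moreover have "(P * P) $$ (i, j) = (P *\<^sub>v col P j) $ i"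
    using ij P_carrier by auto
  ultimately show "(P * P) $$ (i, j) = P $$ (i, j)"
    using ij P_carrier by auto
qed (use P_carrier in auto)

lemma P_symmetric: "transpose_mat P = P"
  by (rule eq_matI) (auto simp: P_def)

text \<open>\<open>P\<close> is singular because it kills \<open>w\<close>, and it differs from the identity by a matrix of rank
  at most one.\<close>

lemma P_rank: "vec_space.rank n P = n - 1"
proof -
  interpret vec_space "TYPE(real)" n .
  have "w \<noteq> 0\<^sub>v n" using w_unit by auto
  then have "det P = 0"
    using det_0_iff_vec_prod_zero[OF P_carrier] w_carrier P_mult_w by blast
  then have "rank P \<noteq> n" using det_rank_iff[OF P_carrier] by blast
  moreover have "rank P \<le> n" using rank_le_nc[OF P_carrier] .
  moreover have "n \<le> rank P + 1"
  proof -
    let ?W = "mat n n (\<lambda>(i, j). w $ i * w $ j)"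
    have "1\<^sub>m n = P + ?W"
      by (rule eq_matI) (auto simp: P_def)
    then have "rank (1\<^sub>m n) \<le> rank P + rank ?W"
      using rank_subadditive[OF P_carrier, of ?W] by simp
    moreover have "rank ?W \<le> 1"
      by (rule rank_le_1_product_entries[where nc = n and f = "vec_index w" and g = "vec_index w"])
        auto
    \<comment> \<open>A smaller rank would force determinant zero, while the identity has
      determinant one.\<close>
    moreover have "rank (1\<^sub>m n) = n"
      by (rule low_rank_det_zero) auto
    ultimately show ?thesis by linarith
  qed
  ultimately show ?thesis by linarith
qed

lemma P_projection: "orthogonal_projection n (n - 1) P"
  by (simp add: orthogonal_projection_def P_carrier P_idempotent P_symmetric P_rank)

lemma D_mult_vec:
  assumes "\<beta> \<in> carrier_vec p"
  shows "D *\<^sub>v \<beta> = vec p (\<lambda>j. \<tau> / a j * \<beta> $ j)"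
proof (rule eq_vecI)
  fix i assume "i < dim_vec (vec p (\<lambda>j. \<tau> / a j * \<beta> $ j))"
  then have i: "i < p" by simp
  have "(D *\<^sub>v \<beta>) $ i = (\<Sum>j<p. (if i = j then \<tau> / a j else 0) * \<beta> $ j)"
    using assms i by (simp add: D_def scalar_prod_def atLeast0LessThan)
  also have "\<dots> = (\<Sum>j<p. if i = j then \<tau> / a j * \<beta> $ j else 0)"
    by (intro sum.cong) auto
  finally show "(D *\<^sub>v \<beta>) $ i = vec p (\<lambda>j. \<tau> / a j * \<beta> $ j) $ i"
    using i by simp
qed (use D_carrier in auto)

lemma D_mult_nonneg_orthant:
  assumes "\<beta> \<in> nonneg_orthant p"
  shows "D *\<^sub>v \<beta> \<in> nonneg_orthant p"
  using assms D_mult_vec[of \<beta>] a_pos \<tau>_pos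
  by (auto simp: nonneg_orthant_iff intro!: mult_nonneg_nonneg divide_nonneg_pos)

text \<open>The inverse diagonal \<open>a j / \<tau>\<close> is positive too, so a minimizer of the
  original problem can be used as a competitor in the regularized one.\<close>

lemma D_surj_nonneg_orthant:
  assumes "\<beta> \<in> nonneg_orthant p"
  obtains \<gamma> where "\<gamma> \<in> nonneg_orthant p" "D *\<^sub>v \<gamma> = \<beta>"
proof
  let ?\<gamma> = "vec p (\<lambda>j. a j / \<tau> * \<beta> $ j)"
  show "?\<gamma> \<in> nonneg_orthant p"
    using assms a_pos \<tau>_pos
    by (auto simp: nonneg_orthant_iff less_imp_le intro!: mult_nonneg_nonneg divide_nonneg_pos)
  show "D *\<^sub>v ?\<gamma> = \<beta>"
    using assms a_pos \<tau>_pos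
    by (subst D_mult_vec) (auto simp: nonneg_orthant_iff less_imp_neq[symmetric] intro!: eq_vecI)
qed

section \<open>The component of the fit along \<open>w\<close>\<close>

lemma X_mult_carrier: "X *\<^sub>v \<beta> \<in> carrier_vec n"
  using X_carrier by (intro carrier_vecI) simp

lemma s_eq_sum:
  assumes "\<beta> \<in> carrier_vec p"
  shows "s \<beta> = sqrt (real n) * (\<Sum>j<p. a j * \<beta> $ j)"
proof -
  have "s \<beta> = (transpose_mat X *\<^sub>v w) \<bullet> \<beta>"
    unfolding s_def using transpose_vec_mult_scalar[OF X_carrier assms w_carrier] by simp
  also have "\<dots> = (\<Sum>j<p. (col X j \<bullet> w) * \<beta> $ j)"
    using assms X_carrier by (simp add: scalar_prod_def[of _ \<beta>] atLeast0LessThan)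
  finally show ?thesis
    using n_pos by (simp add: a_def sum_distrib_left)
qed

text \<open>This is the self-regularizing effect: every column has component at least
  \<open>\<tau> * sqrt (real n)\<close> along \<open>w\<close>, and nonnegative coefficients rule
  out cancellation.\<close>

lemma s_ge:
  assumes "\<beta> \<in> nonneg_orthant p"
  shows "\<tau> * sqrt (real n) * (\<Sum>j<p. \<beta> $ j) \<le> s \<beta>"
proof -
  have "\<tau> * (\<Sum>j<p. \<beta> $ j) \<le> (\<Sum>j<p. a j * \<beta> $ j)"
    unfolding sum_distrib_left using assms a_bounds
    by (intro sum_mono mult_right_mono) (auto simp: nonneg_orthant_iff)
  then have "sqrt (real n) * (\<tau> * (\<Sum>j<p. \<beta> $ j)) \<le> sqrt (real n) * (\<Sum>j<p. a j * \<beta> $ j)"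
    by (intro mult_left_mono) auto
  then show ?thesis
    using assms by (simp add: s_eq_sum nonneg_orthant_iff ac_simps)
qed

lemma s_nonneg:
  assumes "\<beta> \<in> nonneg_orthant p"
  shows "0 \<le> s \<beta>"
proof -
  have "0 \<le> \<tau> * sqrt (real n) * (\<Sum>j<p. \<beta> $ j)"
    using assms \<tau>_pos by (auto simp: nonneg_orthant_iff intro!: mult_nonneg_nonneg sum_nonneg)
  then show ?thesis using s_ge[OF assms] by linarith
qed

text \<open>Supplies the box needed for the existence of a minimizer.\<close>

lemma coord_le_of_s_le:
  assumes "\<beta> \<in> nonneg_orthant p" "s \<beta> \<le> B" "j < p"
  shows "\<beta> $ j \<le> B / (\<tau> * sqrt (real n))"
proof -
  have "\<beta> $ j \<le> (\<Sum>j<p. \<beta> $ j)"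
    using assms by (intro member_le_sum) (auto simp: nonneg_orthant_iff)
  also have "\<dots> \<le> B / (\<tau> * sqrt (real n))"
    using s_ge[OF assms(1)] assms(2) \<tau>_pos n_pos by (simp add: field_simps)
  finally show ?thesis .
qed

text \<open>The factors \<open>a j\<close> cancel against those in \<open>D\<close>. Thus the
  penalty \<open>\<tau>\<^sup>2 * (ones_vec p \<bullet> \<gamma>)\<^sup>2\<close> is the squared
  component along \<open>w\<close> divided by \<open>n\<close>.\<close>

lemma s_D_mult:
  assumes "\<gamma> \<in> carrier_vec p"
  shows "s (D *\<^sub>v \<gamma>) = \<tau> * sqrt (real n) * (ones_vec p \<bullet> \<gamma>)"
proof -
  have "s (D *\<^sub>v \<gamma>) = sqrt (real n) * (\<Sum>j<p. a j * (\<tau> / a j * \<gamma> $ j))"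
    using assms by (simp add: s_eq_sum D_mult_vec)
  also have "(\<Sum>j<p. a j * (\<tau> / a j * \<gamma> $ j)) = (\<Sum>j<p. \<tau> * \<gamma> $ j)"
    using a_pos by (intro sum.cong) (auto simp: less_imp_neq[symmetric])
  finally show ?thesis
    using assms by (simp add: ones_vec_scalar_prod sum_distrib_left ac_simps)
qed

section \<open>The regularized objective and its relation to the original one\<close>

definition regularized_objective :: "real vec \<Rightarrow> real vec \<Rightarrow> real" where
  "regularized_objective y \<gamma> =
     nnls_objective ((P * X) * D) y \<gamma> + \<tau>\<^sup>2 * (ones_vec p \<bullet> \<gamma>)\<^sup>2"

lemma objective_eq: "nnls_objective X y \<beta> = (l2_norm (y - X *\<^sub>v \<beta>))\<^sup>2 / real n"
  using X_carrier by (simp add: nnls_objective_def)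

lemma regularized_objective_eq_residual:
  assumes "\<gamma> \<in> carrier_vec p"
  shows "regularized_objective y \<gamma> =
    ((l2_norm (y - P *\<^sub>v (X *\<^sub>v (D *\<^sub>v \<gamma>))))\<^sup>2 + (s (D *\<^sub>v \<gamma>))\<^sup>2) / real n"
proof -
  have "((P * X) * D) *\<^sub>v \<gamma> = (P * X) *\<^sub>v (D *\<^sub>v \<gamma>)"
    using assoc_mult_mat_vec[of "P * X" n p D p \<gamma>] P_carrier X_carrier D_carrier assms by auto
  also have "\<dots> = P *\<^sub>v (X *\<^sub>v (D *\<^sub>v \<gamma>))"
    using mult_mat_vec_carrier[OF D_carrier assms] by (rule assoc_mult_mat_vec[OF P_carrier X_carrier])
  finally have "nnls_objective ((P * X) * D) y \<gamma> =
      (l2_norm (y - P *\<^sub>v (X *\<^sub>v (D *\<^sub>v \<gamma>))))\<^sup>2 / real n"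
    using P_carrier by (simp add: nnls_objective_def)
  moreover have "\<tau>\<^sup>2 * (ones_vec p \<bullet> \<gamma>)\<^sup>2 = (s (D *\<^sub>v \<gamma>))\<^sup>2 / real n"
    using n_pos by (simp add: s_D_mult[OF assms] power_mult_distrib)
  ultimately show ?thesis
    by (simp add: regularized_objective_def add_divide_distrib)
qed

text \<open>With u the fit and t its component along \<open>w\<close>, the projected residual is (y
  - u) + t w. Expanding its square adds 2 t (w . y) - t^2 to the square of y - u, and the penalty
  restores t^2, leaving only the term linear in t.\<close>

lemma regularized_objective_eq:
  assumes y: "y \<in> carrier_vec n" and \<gamma>: "\<gamma> \<in> carrier_vec p"
  shows "regularized_objective y \<gamma> =
    nnls_objective X y (D *\<^sub>v \<gamma>) + 2 * s (D *\<^sub>v \<gamma>) * (w \<bullet> y) / real n"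
proof -
  define u where "u = X *\<^sub>v (D *\<^sub>v \<gamma>)"
  define t where "t = w \<bullet> u"
  have u: "u \<in> carrier_vec n" unfolding u_def by (rule X_mult_carrier)
  have t: "t = s (D *\<^sub>v \<gamma>)" by (simp add: t_def s_def u_def)
  have *: "y - P *\<^sub>v u = (y - u) + t \<cdot>\<^sub>v w"
    using P_mult_vec[OF u] y u w_carrier by (intro eq_vecI) (auto simp: t_def)
  have yu: "y - u \<in> carrier_vec n" and tw: "t \<cdot>\<^sub>v w \<in> carrier_vec n"
    using y u w_carrier by auto
  have wyu: "w \<bullet> (y - u) = w \<bullet> y - t"
    using scalar_prod_minus_distrib[OF w_carrier y u] by (simp add: t_def)
  have "(l2_norm (y - P *\<^sub>v u))\<^sup>2 = ((y - u) + t \<cdot>\<^sub>v w) \<bullet> ((y - u) + t \<cdot>\<^sub>v w)"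
    by (simp add: l2_norm_power2 *)
  also have "\<dots> = (y - u) \<bullet> (y - u) + 2 * t * (w \<bullet> (y - u)) + t * t * (w \<bullet> w)"
    using yu tw w_carrier comm_scalar_prod[OF yu w_carrier]
    by (simp add: scalar_prod_add_distrib[of _ n] add_scalar_prod_distrib[of _ n]
        algebra_simps)
  also have "\<dots> = (l2_norm (y - u))\<^sup>2 + 2 * t * (w \<bullet> y) - t\<^sup>2"
    unfolding wyu w_unit l2_norm_power2 by (simp add: algebra_simps power2_eq_square)
  finally have "(l2_norm (y - P *\<^sub>v u))\<^sup>2 + t\<^sup>2 = (l2_norm (y - u))\<^sup>2 + 2 * t * (w \<bullet> y)"
    by simp
  then show ?thesis
    unfolding regularized_objective_eq_residual[OF \<gamma>] objective_eq t[symmetric] u_def[symmetric]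
    by (simp add: add_divide_distrib)
qed

text \<open>The residual is no longer than \<open>y\<close>, hence neither is its component
  \<open>w \<bullet> y - s \<beta>\<close>. Since \<open>w \<bullet> y\<close> obeys the same bound,
  the triangle inequality gives the factor two.\<close>

lemma s_le_of_objective_le:
  assumes y: "y \<in> carrier_vec n"
    and le: "nnls_objective X y \<beta> \<le> nnls_objective X y (0\<^sub>v p)"
  shows "s \<beta> \<le> 2 * l2_norm y"
proof -
  have "X *\<^sub>v 0\<^sub>v p = 0\<^sub>v n" using X_carrier by auto
  then have "(l2_norm (y - X *\<^sub>v \<beta>))\<^sup>2 \<le> (l2_norm y)\<^sup>2"
    using le y n_pos by (simp add: objective_eq divide_le_cancel)
  then have "l2_norm (y - X *\<^sub>v \<beta>) \<le> l2_norm y"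
    using l2_norm_nonneg power2_le_imp_le by blast
  moreover have "\<bar>w \<bullet> (y - X *\<^sub>v \<beta>)\<bar> \<le> l2_norm (y - X *\<^sub>v \<beta>)"
    using y X_mult_carrier by (intro abs_w_scalar_prod_le) auto
  moreover have "w \<bullet> (y - X *\<^sub>v \<beta>) = w \<bullet> y - s \<beta>"
    using scalar_prod_minus_distrib[OF w_carrier y X_mult_carrier] by (simp add: s_def)
  moreover have "\<bar>w \<bullet> y\<bar> \<le> l2_norm y" by (rule abs_w_scalar_prod_le[OF y])
  ultimately show ?thesis by linarith
qed

text \<open>Here the square of \<open>s\<close> is itself a summand of the objective, so it is
  bounded directly by the value at zero.\<close>

lemma s_le_of_regularized_objective_le:
  assumes y: "y \<in> carrier_vec n" and \<gamma>: "\<gamma> \<in> carrier_vec p"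
    and le: "regularized_objective y \<gamma> \<le> regularized_objective y (0\<^sub>v p)"
  shows "s (D *\<^sub>v \<gamma>) \<le> l2_norm y"
proof -
  have z: "D *\<^sub>v 0\<^sub>v p = 0\<^sub>v p" "X *\<^sub>v 0\<^sub>v p = 0\<^sub>v n" "P *\<^sub>v 0\<^sub>v n = 0\<^sub>v n" "s (0\<^sub>v p) = 0"
    using D_carrier X_carrier P_carrier by (auto simp: s_eq_sum)
  have "regularized_objective y (0\<^sub>v p) = (l2_norm y)\<^sup>2 / real n"
    using y by (simp add: regularized_objective_eq_residual z)
  then have "(l2_norm (y - P *\<^sub>v (X *\<^sub>v (D *\<^sub>v \<gamma>))))\<^sup>2 + (s (D *\<^sub>v \<gamma>))\<^sup>2 \<le> (l2_norm y)\<^sup>2"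
    using le n_pos by (simp add: regularized_objective_eq_residual[OF \<gamma>] divide_le_cancel)
  then have "(s (D *\<^sub>v \<gamma>))\<^sup>2 \<le> (l2_norm y)\<^sup>2"
    using zero_le_power2[of "l2_norm (y - P *\<^sub>v (X *\<^sub>v (D *\<^sub>v \<gamma>)))"] by linarith
  then show ?thesis
    using l2_norm_nonneg power2_le_imp_le by blast
qed

section \<open>Existence of minimizers and comparison of the minima\<close>

text \<open>For \<open>p > n\<close> the sublevel sets in the whole space are unbounded, but within
  the orthant the component along \<open>w\<close> bounds every coordinate.\<close>

lemma minimizer_exists:
  assumes y: "y \<in> carrier_vec n"
  obtains \<beta> where "\<beta> \<in> nonneg_orthant p"
    "\<And>\<gamma>. \<gamma> \<in> nonneg_orthant p \<Longrightarrow> nnls_objective X y \<beta> \<le> nnls_objective X y \<gamma>"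
proof (rule nonneg_orthant_attains_min[of "nnls_objective X y" p])
  show "continuous_on UNIV (\<lambda>x. nnls_objective X y (vec p x))"
    by (rule continuous_on_nnls_objective[OF y X_carrier])
  show "\<beta> $ j \<le> 2 * l2_norm y / (\<tau> * sqrt (real n))"
    if "\<beta> \<in> nonneg_orthant p" "nnls_objective X y \<beta> \<le> nnls_objective X y (0\<^sub>v p)" "j < p" for \<beta> j
    using that coord_le_of_s_le s_le_of_objective_le[OF y] by blast
qed (use that in blast)

lemma regularized_minimizer_exists:
  assumes y: "y \<in> carrier_vec n"
  obtains \<beta> where "\<beta> \<in> nonneg_orthant p"
    "\<And>\<gamma>. \<gamma> \<in> nonneg_orthant p \<Longrightarrow> regularized_objective y \<beta> \<le> regularized_objective y \<gamma>"
proof (rule nonneg_orthant_attains_min[of "regularized_objective y" p])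
  have coord: "continuous_on UNIV (\<lambda>x :: nat \<Rightarrow> real. x i)" for i
    by simp
  have "(P * X) * D \<in> carrier_mat n p"
    using P_carrier X_carrier D_carrier by auto
  then show "continuous_on UNIV (\<lambda>x. regularized_objective y (vec p x))"
    unfolding regularized_objective_def
    by (intro continuous_intros continuous_on_nnls_objective[OF y])
      (auto simp: ones_vec_scalar_prod intro!: continuous_intros coord)
  show "\<gamma> $ j \<le> l2_norm y / (\<tau> * sqrt (real n))"
    if \<gamma>: "\<gamma> \<in> nonneg_orthant p" "regularized_objective y \<gamma> \<le> regularized_objective y (0\<^sub>v p)"
      and j: "j < p" for \<gamma> j
  proof -
    have c: "\<gamma> \<in> carrier_vec p" using \<gamma> by (simp add: nonneg_orthant_iff)
    have "\<gamma> $ j \<le> (\<Sum>j<p. \<gamma> $ j)"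
      using \<gamma> j by (intro member_le_sum) (auto simp: nonneg_orthant_iff)
    also have "\<dots> \<le> l2_norm y / (\<tau> * sqrt (real n))"
      using s_le_of_regularized_objective_le[OF y c \<gamma>(2)] \<tau>_pos n_pos
      by (simp add: s_D_mult[OF c] ones_vec_scalar_prod[OF c] field_simps)
    finally show ?thesis .
  qed
qed (use that in blast)

text \<open>Each minimizer, transported by \<open>D\<close>, is a competitor in the other problem.
  This encloses the difference of the minima between two values of the linear term, both controlled
  by the bounds on \<open>s\<close>.\<close>

lemma abs_min_diff_le:
  assumes y: "y \<in> carrier_vec n"
  shows "\<bar>min_over (nonneg_orthant p) (nnls_objective X y)
      - min_over (nonneg_orthant p) (regularized_objective y)\<bar>
    \<le> 2 * ((w \<bullet> y)\<^sup>2 + (y \<bullet> y) / real n) * (1 / sqrt (real n))"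
proof -
  obtain \<beta> where \<beta>: "\<beta> \<in> nonneg_orthant p"
    "\<And>\<gamma>. \<gamma> \<in> nonneg_orthant p \<Longrightarrow> nnls_objective X y \<beta> \<le> nnls_objective X y \<gamma>"
    using minimizer_exists[OF y] by blast
  obtain \<gamma> where \<gamma>: "\<gamma> \<in> nonneg_orthant p"
    "\<And>\<delta>. \<delta> \<in> nonneg_orthant p \<Longrightarrow> regularized_objective y \<gamma> \<le> regularized_objective y \<delta>"
    using regularized_minimizer_exists[OF y] by blast
  obtain \<beta>' where \<beta>': "\<beta>' \<in> nonneg_orthant p" "D *\<^sub>v \<beta>' = \<beta>"
    using D_surj_nonneg_orthant[OF \<beta>(1)] .
  have carrier: "\<gamma> \<in> carrier_vec p" "\<beta>' \<in> carrier_vec p"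
    using \<gamma> \<beta>' by (auto simp: nonneg_orthant_iff)
  let ?f = "min_over (nonneg_orthant p) (nnls_objective X y)"
  let ?g = "min_over (nonneg_orthant p) (regularized_objective y)"
  define z where "z = w \<bullet> y"
  define r where "r = l2_norm y"
  define q where "q = sqrt (real n)"
  have q: "0 < q" "real n = q * q" using n_pos by (auto simp: q_def)
  have f: "?f = nnls_objective X y \<beta>" using \<beta> by (rule min_over_eq)
  have g: "?g = regularized_objective y \<gamma>" using \<gamma> by (rule min_over_eq)
  have s_bound: "\<bar>2 * t * z / real n\<bar> \<le> 4 * (r * \<bar>z\<bar>) / real n" if "0 \<le> t" "t \<le> 2 * r" for t
  proof -
    have "t * \<bar>z\<bar> \<le> 2 * r * \<bar>z\<bar>" using that by (intro mult_right_mono) auto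
    then show ?thesis using that by (simp add: abs_mult divide_right_mono)
  qed
  have "s \<beta> \<le> 2 * r"
    unfolding r_def using \<beta> zero_in_nonneg_orthant by (intro s_le_of_objective_le[OF y]) auto
  then have b1: "\<bar>2 * s \<beta> * z / real n\<bar> \<le> 4 * (r * \<bar>z\<bar>) / real n"
    using s_nonneg[OF \<beta>(1)] by (rule s_bound[rotated])
  have "s (D *\<^sub>v \<gamma>) \<le> r"
    unfolding r_def using \<gamma> zero_in_nonneg_orthant carrier
    by (intro s_le_of_regularized_objective_le[OF y]) auto
  then have "s (D *\<^sub>v \<gamma>) \<le> 2 * r" using l2_norm_nonneg[of y] by (simp add: r_def)
  then have b2: "\<bar>2 * s (D *\<^sub>v \<gamma>) * z / real n\<bar> \<le> 4 * (r * \<bar>z\<bar>) / real n"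
    using s_nonneg[OF D_mult_nonneg_orthant[OF \<gamma>(1)]] by (rule s_bound[rotated])
  have "?g \<le> ?f + 2 * s \<beta> * z / real n"
    using \<gamma>(2)[OF \<beta>'(1)] regularized_objective_eq[OF y carrier(2)]
    by (simp add: f g \<beta>'(2) z_def)
  moreover have "?f + 2 * s (D *\<^sub>v \<gamma>) * z / real n \<le> ?g"
    using \<beta>(2)[OF D_mult_nonneg_orthant[OF \<gamma>(1)]] regularized_objective_eq[OF y carrier(1)]
    by (simp add: f g z_def)
  ultimately have "\<bar>?f - ?g\<bar> \<le> 4 * (r * \<bar>z\<bar>) / real n"
    using b1 b2 by linarith
  \<comment> \<open>One factor \<open>1 / q\<close> is split off as the rate; the rest is a product
    to which 2 a b \<le> a^2 + b^2 applies, leaving squares whose expectations are governed by the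
    variances.\<close>
  also have "\<dots> = 2 * (2 * \<bar>z\<bar> * (r / q)) * (1 / q)"
    by (simp add: q)
  also have "\<dots> \<le> 2 * (z\<^sup>2 + (r / q)\<^sup>2) * (1 / q)"
    using sum_squares_bound[of "\<bar>z\<bar>" "r / q"] q
    by (intro mult_right_mono) auto
  also have "(r / q)\<^sup>2 = (y \<bullet> y) / real n"
    by (simp add: power_divide q r_def l2_norm_power2 power2_eq_square[of q])
  finally show ?thesis by (simp add: z_def q_def)
qed

section \<open>A bound for the prediction error\<close>

text \<open>Comparison with zero gives \<open>x\<^sup>2 \<le> 2 * (L * b)\<close>, and
  \<open>s_ge\<close> gives \<open>b \<le> x / (\<tau> * q)\<close>. Together they allow one factor
  \<open>x\<close> to be cancelled, so the squared error becomes quadratic in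
  \<open>L\<close>.\<close>

lemma prediction_error_le:
  assumes y: "y \<in> carrier_vec n" and \<beta>: "\<beta> \<in> nonneg_orthant p"
    and le: "nnls_objective X y \<beta> \<le> nnls_objective X y (0\<^sub>v p)"
  shows "(1 / real n) * (l2_norm (X *\<^sub>v \<beta>))\<^sup>2
    \<le> ((2 / \<tau>) * ((1 / real n) * linf_norm (transpose_mat X *\<^sub>v y)))\<^sup>2"
proof -
  define u where "u = X *\<^sub>v \<beta>"
  define x where "x = l2_norm u"
  define L where "L = linf_norm (transpose_mat X *\<^sub>v y)"
  define b where "b = (\<Sum>j<p. \<beta> $ j)"
  define q where "q = sqrt (real n)"
  have q: "0 < q" "real n = q * q" using n_pos by (auto simp: q_def)
  have \<beta>c: "\<beta> \<in> carrier_vec p" using \<beta> by (simp add: nonneg_orthant_iff)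
  have u: "u \<in> carrier_vec n" unfolding u_def by (rule X_mult_carrier)
  have x: "0 \<le> x" by (simp add: x_def l2_norm_nonneg)
  have b: "0 \<le> b" using \<beta> by (auto simp: b_def nonneg_orthant_iff intro: sum_nonneg)
  have "X *\<^sub>v 0\<^sub>v p = 0\<^sub>v n" using X_carrier by auto
  then have "(l2_norm (y - u))\<^sup>2 \<le> (l2_norm y)\<^sup>2"
    using le y n_pos by (simp add: objective_eq divide_le_cancel u_def)
  then have "(y - u) \<bullet> (y - u) \<le> y \<bullet> y" by (simp add: l2_norm_power2)
  moreover have "(y - u) \<bullet> (y - u) = y \<bullet> y - 2 * (y \<bullet> u) + u \<bullet> u"
    using y u comm_scalar_prod[OF u y]
    by (simp add: scalar_prod_minus_distrib[of _ n] minus_scalar_prod_distrib[of _ n])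
  ultimately have "x\<^sup>2 \<le> 2 * (y \<bullet> u)" by (simp add: x_def l2_norm_power2)
  also have "y \<bullet> u = (transpose_mat X *\<^sub>v y) \<bullet> \<beta>"
    unfolding u_def using transpose_vec_mult_scalar[OF X_carrier \<beta>c y] by simp
  also have "\<dots> \<le> L * b"
    unfolding L_def b_def using X_carrier \<beta>
    by (intro scalar_prod_le_linf_norm carrier_vecI) auto
  finally have x2: "x\<^sup>2 \<le> 2 * (L * b)" by simp
  have "\<tau> * q * b \<le> x"
    using s_ge[OF \<beta>] abs_w_scalar_prod_le[OF u]
    unfolding s_def u_def[symmetric] x_def q_def b_def by linarith
  then have bx: "b \<le> x / (\<tau> * q)" using \<tau>_pos q by (simp add: field_simps)
  \<comment> \<open>The absolute value covers \<open>p = 0\<close>, which the locale admits and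
    where \<open>L\<close> is an unspecified maximum of the empty set; squaring removes it at the
    end.\<close>
  have "x \<le> 2 * \<bar>L\<bar> / (\<tau> * q)"
  proof (cases "x = 0")
    case False
    have "x * x \<le> 2 * (\<bar>L\<bar> * b)"
      using x2 mult_right_mono[OF abs_ge_self[of L] b] by (simp add: power2_eq_square)
    also have "\<dots> \<le> 2 * (\<bar>L\<bar> * (x / (\<tau> * q)))"
      using bx by (intro mult_left_mono) auto
    also have "\<dots> = (2 * \<bar>L\<bar> / (\<tau> * q)) * x" by simp
    finally show ?thesis by (rule mult_right_le_imp_le) (use False x in simp)
  qed (use \<tau>_pos q in simp)
  then have "x / q \<le> (2 * \<bar>L\<bar> / (\<tau> * q)) / q"
    using q by (intro divide_right_mono) auto
  then have "x / q \<le> (2 / \<tau>) * ((1 / real n) * \<bar>L\<bar>)"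
    by (simp add: q field_simps)
  then have "(x / q)\<^sup>2 \<le> ((2 / \<tau>) * ((1 / real n) * \<bar>L\<bar>))\<^sup>2"
    using x q by (intro power_mono) auto
  then show ?thesis
    by (simp add: q(2) power_mult_distrib power_divide x_def[symmetric] L_def[symmetric]
        u_def[symmetric] power2_eq_square)
qed

end

section \<open>Second moments of weighted sums and stochastic order symbols\<close>

text \<open>In the expanded double sum the mixed terms vanish, because independence factorizes their
  expectations into means, which are zero.\<close>

lemma (in prob_space)
  fixes Y :: "'i \<Rightarrow> 'a \<Rightarrow> real"
  assumes I: "finite I"
    and indep: "indep_vars (\<lambda>_. borel) Y I"
    and int: "\<And>i. i \<in> I \<Longrightarrow> integrable M (Y i)"
    and mean: "\<And>i. i \<in> I \<Longrightarrow> expectation (Y i) = 0"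
    and sq: "\<And>i. i \<in> I \<Longrightarrow> integrable M (\<lambda>\<omega>. (Y i \<omega>)\<^sup>2)"
  shows integrable_weighted_sum_square: "integrable M (\<lambda>\<omega>. (\<Sum>i\<in>I. c i * Y i \<omega>)\<^sup>2)"
    and expectation_weighted_sum_square:
      "expectation (\<lambda>\<omega>. (\<Sum>i\<in>I. c i * Y i \<omega>)\<^sup>2) = (\<Sum>i\<in>I. (c i)\<^sup>2 * variance (Y i))"
proof -
  have prod_int: "integrable M (\<lambda>\<omega>. Y i \<omega> * Y j \<omega>)"
    and prod_exp: "expectation (\<lambda>\<omega>. Y i \<omega> * Y j \<omega>) = (if i = j then variance (Y i) else 0)"
    if "i \<in> I" "j \<in> I" for i j
  proof -
    have ij: "indep_vars (\<lambda>_. borel) Y {i, j}"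
      by (rule indep_vars_subset[OF indep]) (use that in blast)
    have int': "integrable M (Y k)" if "k \<in> {i, j}" for k
      using that \<open>i \<in> I\<close> \<open>j \<in> I\<close> int by auto
    show "integrable M (\<lambda>\<omega>. Y i \<omega> * Y j \<omega>)"
    proof (cases "i = j")
      case True
      then show ?thesis using sq[OF \<open>i \<in> I\<close>] by (simp add: power2_eq_square)
    next
      case False
      then show ?thesis using indep_vars_integrable[OF _ ij int'] by simp
    qed
    show "expectation (\<lambda>\<omega>. Y i \<omega> * Y j \<omega>) = (if i = j then variance (Y i) else 0)"
    proof (cases "i = j")
      case True
      then show ?thesis using mean[OF \<open>i \<in> I\<close>] by (simp add: power2_eq_square)
    next
      case False
      then show ?thesis
        using indep_vars_lebesgue_integral[OF _ ij int'] mean[OF \<open>i \<in> I\<close>] by simp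
    qed
  qed
  have expand: "(\<Sum>i\<in>I. c i * Y i \<omega>)\<^sup>2 = (\<Sum>i\<in>I. \<Sum>j\<in>I. c i * c j * (Y i \<omega> * Y j \<omega>))" for \<omega>
    by (simp add: power2_eq_square sum_product ac_simps)
  show "integrable M (\<lambda>\<omega>. (\<Sum>i\<in>I. c i * Y i \<omega>)\<^sup>2)"
    unfolding expand using prod_int by (intro Bochner_Integration.integrable_sum) auto
  have "expectation (\<lambda>\<omega>. (\<Sum>i\<in>I. c i * Y i \<omega>)\<^sup>2) =
      (\<Sum>i\<in>I. expectation (\<lambda>\<omega>. \<Sum>j\<in>I. c i * c j * (Y i \<omega> * Y j \<omega>)))"
    unfolding expand using prod_int
    by (intro Bochner_Integration.integral_sum Bochner_Integration.integrable_sum) auto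
  also have "\<dots> = (\<Sum>i\<in>I. \<Sum>j\<in>I. expectation (\<lambda>\<omega>. c i * c j * (Y i \<omega> * Y j \<omega>)))"
    using prod_int by (intro sum.cong refl Bochner_Integration.integral_sum) auto
  also have "\<dots> = (\<Sum>i\<in>I. \<Sum>j\<in>I. c i * c j * expectation (\<lambda>\<omega>. Y i \<omega> * Y j \<omega>))"
    by simp
  also have "\<dots> = (\<Sum>i\<in>I. \<Sum>j\<in>I. if i = j then c i * c j * variance (Y i) else 0)"
    using prod_exp by (intro sum.cong refl) auto
  also have "\<dots> = (\<Sum>i\<in>I. (c i)\<^sup>2 * variance (Y i))"
    using I by (simp add: power2_eq_square)
  finally show "expectation (\<lambda>\<omega>. (\<Sum>i\<in>I. c i * Y i \<omega>)\<^sup>2) = (\<Sum>i\<in>I. (c i)\<^sup>2 * variance (Y i))" .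
qed

text \<open>Markov's inequality for the dominating variable \<open>W\<close>. Only \<open>W\<close>
  has to be measurable: monotonicity of the outer measure transfers the bound to
  \<open>Z\<close>.\<close>

lemma bigO_P_of_expectation_le:
  fixes Z W :: "nat \<Rightarrow> 'a \<Rightarrow> real"
  assumes M: "\<And>n. n \<ge> 1 \<Longrightarrow> prob_space (M n)"
    and int: "\<And>n. n \<ge> 1 \<Longrightarrow> integrable (M n) (W n)"
    and K: "\<And>n. n \<ge> 1 \<Longrightarrow> integral\<^sup>L (M n) (W n) \<le> K"
    and nonneg: "\<And>n \<omega>. \<lbrakk>n \<ge> 1; \<omega> \<in> space (M n)\<rbrakk> \<Longrightarrow> 0 \<le> W n \<omega>"
    and a: "\<And>n. n \<ge> 1 \<Longrightarrow> 0 < a n"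
    and Z: "\<And>n \<omega>. \<lbrakk>n \<ge> 1; \<omega> \<in> space (M n)\<rbrakk> \<Longrightarrow> \<bar>Z n \<omega>\<bar> \<le> W n \<omega> * a n"
  shows "bigO_P M Z a"
  unfolding bigO_P_def
proof (intro allI impI)
  fix \<delta> :: real assume \<delta>: "\<delta> > 0"
  \<comment> \<open>Chosen so that \<open>K / C < \<delta>\<close>; the added one keeps
    \<open>C\<close> positive even for \<open>K = 0\<close>.\<close>
  define C where "C = \<bar>K\<bar> / \<delta> + 1"
  have C: "0 < C" using \<delta> by (simp add: C_def add_nonneg_pos)
  have KC: "K / C < \<delta>"
  proof -
    have "K \<le> \<bar>K\<bar>" by simp
    also have "\<dots> < \<delta> * C" using \<delta> by (simp add: C_def algebra_simps)
    finally show ?thesis using C by (simp add: field_simps)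
  qed
  have "outer_measure_of (M n) {\<omega> \<in> space (M n). \<bar>Z n \<omega>\<bar> > C * a n} < ennreal \<delta>"
    if n: "n \<ge> 1" for n
  proof -
    have [measurable]: "W n \<in> borel_measurable (M n)" using int[OF n] by auto
    let ?E = "{\<omega> \<in> space (M n). C \<le> W n \<omega>}"
    have "{\<omega> \<in> space (M n). \<bar>Z n \<omega>\<bar> > C * a n} \<subseteq> ?E"
    proof safe
      fix \<omega> assume \<omega>: "\<omega> \<in> space (M n)" "C * a n < \<bar>Z n \<omega>\<bar>"
      then have "C * a n < W n \<omega> * a n" using Z[OF n] by fastforce
      then show "C \<le> W n \<omega>" using a[OF n] by simp
    qed
    then have "outer_measure_of (M n) {\<omega> \<in> space (M n). \<bar>Z n \<omega>\<bar> > C * a n}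
        \<le> outer_measure_of (M n) ?E"
      by (rule outer_measure_of_mono)
    also have "\<dots> = emeasure (M n) ?E"
      by (rule outer_measure_of_eq) measurable
    also have "\<dots> \<le> ennreal ((1 / C) * integral\<^sup>L (M n) (W n))"
      by (rule integral_Markov_inequality) (use int n nonneg C in auto)
    also have "\<dots> \<le> ennreal (K / C)"
      using K[OF n] C by (intro ennreal_leI) (simp add: divide_right_mono)
    also have "\<dots> < ennreal \<delta>"
      using KC \<delta> by (simp add: ennreal_lessI)
    finally show ?thesis .
  qed
  then show "\<exists>C. \<forall>\<^sub>F n in sequentially.
      outer_measure_of (M n) {\<omega> \<in> space (M n). \<bar>Z n \<omega>\<bar> > C * a n} < ennreal \<delta>"
    unfolding eventually_sequentially by blast
qed

text \<open>The event that \<open>Z\<close> exceeds \<open>c\<close> lies in the event that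
  \<open>V\<close> exceeds \<open>sqrt c / k\<close>. Inclusion suffices for outer measures, so
  \<open>Z\<close> may come from an arbitrary choice of minimizers.\<close>

lemma smallo_P_of_le_square:
  fixes Z V :: "nat \<Rightarrow> 'a \<Rightarrow> real"
  assumes V: "smallo_P M V (\<lambda>_. 1)" and k: "0 < k"
    and Z: "\<And>n \<omega>. \<lbrakk>n \<ge> 1; \<omega> \<in> space (M n)\<rbrakk> \<Longrightarrow> \<bar>Z n \<omega>\<bar> \<le> (k * V n \<omega>)\<^sup>2"
  shows "smallo_P M Z (\<lambda>_. 1)"
  unfolding smallo_P_def
proof (intro allI impI)
  fix c :: real assume c: "c > 0"
  define d where "d = sqrt c / k"
  have "d > 0" using c k by (simp add: d_def)
  then have lim: "(\<lambda>n. outer_measure_of (M n) {\<omega> \<in> space (M n). \<bar>V n \<omega>\<bar> > d * 1}) \<longlonglongrightarrow> 0"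
    using V unfolding smallo_P_def by blast
  have "outer_measure_of (M n) {\<omega> \<in> space (M n). \<bar>Z n \<omega>\<bar> > c * 1}
      \<le> outer_measure_of (M n) {\<omega> \<in> space (M n). \<bar>V n \<omega>\<bar> > d * 1}" if n: "n \<ge> 1" for n
  proof (rule outer_measure_of_mono, safe)
    fix \<omega> assume \<omega>: "\<omega> \<in> space (M n)" "c * 1 < \<bar>Z n \<omega>\<bar>"
    then have "c < (k * V n \<omega>)\<^sup>2" using Z[OF n] by fastforce
    then have "sqrt c < \<bar>k * V n \<omega>\<bar>" using real_sqrt_less_mono by fastforce
    then show "d * 1 < \<bar>V n \<omega>\<bar>" using k by (simp add: d_def abs_mult field_simps)
  qed
  then have "\<forall>\<^sub>F n in sequentially. outer_measure_of (M n) {\<omega> \<in> space (M n). \<bar>Z n \<omega>\<bar> > c * 1}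
      \<le> outer_measure_of (M n) {\<omega> \<in> space (M n). \<bar>V n \<omega>\<bar> > d * 1}"
    unfolding eventually_sequentially by blast
  then show "(\<lambda>n. outer_measure_of (M n) {\<omega> \<in> space (M n). \<bar>Z n \<omega>\<bar> > c * 1}) \<longlonglongrightarrow> 0"
    using lim by (intro tendsto_sandwich[OF _ _ tendsto_const lim]) auto
qed

section \<open>Passage from single designs to the triangular array\<close>

theorem proposition1:
  fixes p :: "nat \<Rightarrow> nat" and X :: "nat \<Rightarrow> real mat"
    and M :: "nat \<Rightarrow> 'a measure" and \<epsilon> :: "nat \<Rightarrow> 'a \<Rightarrow> real vec"
    and \<tau> \<sigma> :: real
  assumes p_pos: "\<And>n. n \<ge> 1 \<Longrightarrow> p n \<ge> 1"
    and X_dim: "\<And>n. n \<ge> 1 \<Longrightarrow> X n \<in> carrier_mat n (p n)"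
    and X_normalized: "\<And>n j. n \<ge> 1 \<Longrightarrow> j < p n \<Longrightarrow> (l2_norm (col (X n) j))\<^sup>2 = real n"
    and X_selfreg: "self_regularizing X \<tau>"
    and M_prob: "\<And>n. n \<ge> 1 \<Longrightarrow> prob_space (M n)"
    and eps_dim: "\<And>n \<omega>. n \<ge> 1 \<Longrightarrow> \<omega> \<in> space (M n) \<Longrightarrow> \<epsilon> n \<omega> \<in> carrier_vec n"
    and eps_indep: "\<And>n. n \<ge> 1 \<Longrightarrow>
      prob_space.indep_vars (M n) (\<lambda>_. borel) (\<lambda>i \<omega>. \<epsilon> n \<omega> $ i) {..<n}"
    and eps_integrable: "\<And>n i. n \<ge> 1 \<Longrightarrow> i < n \<Longrightarrow> integrable (M n) (\<lambda>\<omega>. \<epsilon> n \<omega> $ i)"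
    and eps_mean: "\<And>n i. n \<ge> 1 \<Longrightarrow> i < n \<Longrightarrow> prob_space.expectation (M n) (\<lambda>\<omega>. \<epsilon> n \<omega> $ i) = 0"
    and eps_sq_integrable: "\<And>n i. n \<ge> 1 \<Longrightarrow> i < n \<Longrightarrow> integrable (M n) (\<lambda>\<omega>. (\<epsilon> n \<omega> $ i)\<^sup>2)"
    and eps_variance: "\<And>n i. n \<ge> 1 \<Longrightarrow> i < n \<Longrightarrow>
      prob_space.variance (M n) (\<lambda>\<omega>. \<epsilon> n \<omega> $ i) \<le> \<sigma>\<^sup>2"
  shows "(\<exists>P D :: nat \<Rightarrow> real mat.
           (\<forall>n\<ge>1. orthogonal_projection n (n - 1) (P n) \<and>
                  D n \<in> carrier_mat (p n) (p n) \<and> diagonal_mat (D n) \<and>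
                  (\<forall>j<p n. D n $$ (j, j) \<in> {\<tau>..1})) \<and>
           bigO_P M
             (\<lambda>n \<omega>. min_over (nonneg_orthant (p n)) (nnls_objective (X n) (\<epsilon> n \<omega>))
                    - min_over (nonneg_orthant (p n))
                        (\<lambda>\<beta>. nnls_objective ((P n * X n) * D n) (\<epsilon> n \<omega>) \<beta>
                              + \<tau>\<^sup>2 * (ones_vec (p n) \<bullet> \<beta>)\<^sup>2))
             (\<lambda>n. 1 / sqrt (real n)))
       \<and> (smallo_P M (\<lambda>n \<omega>. (1 / real n) * linf_norm (transpose_mat (X n) *\<^sub>v \<epsilon> n \<omega>)) (\<lambda>_. 1)
          \<longrightarrow> (\<forall>\<beta>hat :: nat \<Rightarrow> 'a \<Rightarrow> real vec.
                (\<forall>n\<ge>1. \<forall>\<omega>\<in>space (M n).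
                   is_arg_min (nnls_objective (X n) (\<epsilon> n \<omega>))
                     (\<lambda>\<beta>. \<beta> \<in> nonneg_orthant (p n)) (\<beta>hat n \<omega>))
                \<longrightarrow> smallo_P M (\<lambda>n \<omega>. (1 / real n) * (l2_norm (X n *\<^sub>v \<beta>hat n \<omega>))\<^sup>2) (\<lambda>_. 1)))"
proof -
  have \<tau>: "0 < \<tau>" "\<And>n. n \<ge> 1 \<Longrightarrow> \<tau> \<le> tau0 (X n)"
    using X_selfreg by (auto simp: self_regularizing_def)
  have "\<exists>w. w \<in> carrier_vec n \<and> w \<bullet> w = 1 \<and>
      (\<forall>j<p n. \<tau> * sqrt (real n) \<le> col (X n) j \<bullet> w)" if n: "n \<ge> 1" for n
    using self_regularizing_direction[OF X_dim[OF n] n p_pos[OF n] \<tau>(1) \<tau>(2)[OF n]] by metis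
  then obtain w where w: "\<And>n. n \<ge> 1 \<Longrightarrow> w n \<in> carrier_vec n \<and> w n \<bullet> w n = 1 \<and>
      (\<forall>j<p n. \<tau> * sqrt (real n) \<le> col (X n) j \<bullet> w n)"
    by metis
  have design: "self_regularizing_design n (p n) (X n) (w n) \<tau>" if n: "n \<ge> 1" for n
    using n X_dim X_normalized w \<tau> by unfold_locales auto
  define Pm where "Pm n = self_regularizing_design.P n (w n)" for n
  define Dm where "Dm n = self_regularizing_design.D n (p n) (X n) (w n) \<tau>" for n
  \<comment> \<open>The bound from \<open>abs_min_diff_le\<close> without its factor
    \<open>1 / sqrt (real n)\<close>. Both summands in the bracket have expectation at most
    \<open>\<sigma>\<^sup>2\<close>, the first because \<open>w n\<close> has unit length, the
    second as an average of variances.\<close>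
  define W where "W n \<omega> = 2 * ((w n \<bullet> \<epsilon> n \<omega>)\<^sup>2 + (\<epsilon> n \<omega> \<bullet> \<epsilon> n \<omega>) / real n)" for n \<omega>
  have matrices: "\<forall>n\<ge>1. orthogonal_projection n (n - 1) (Pm n) \<and>
      Dm n \<in> carrier_mat (p n) (p n) \<and> diagonal_mat (Dm n) \<and>
      (\<forall>j<p n. Dm n $$ (j, j) \<in> {\<tau>..1})"
  proof (intro allI impI)
    fix n :: nat assume "n \<ge> 1"
    then interpret self_regularizing_design n "p n" "X n" "w n" \<tau>
      by (rule design)
    show "orthogonal_projection n (n - 1) (Pm n) \<and>
        Dm n \<in> carrier_mat (p n) (p n) \<and> diagonal_mat (Dm n) \<and>
        (\<forall>j<p n. Dm n $$ (j, j) \<in> {\<tau>..1})"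
      unfolding Pm_def Dm_def using P_projection D_carrier D_diagonal D_entries by blast
  qed
  have W: "integrable (M n) (W n) \<and> integral\<^sup>L (M n) (W n) \<le> 4 * \<sigma>\<^sup>2" if n: "n \<ge> 1" for n
  proof -
    interpret prob_space "M n" by (rule M_prob[OF n])
    \<comment> \<open>The equation is restricted to the sample space because the dimension of
      \<open>\<epsilon> n \<omega>\<close> is known only there.\<close>
    have W_eq: "W n \<omega> = 2 * ((\<Sum>i<n. w n $ i * \<epsilon> n \<omega> $ i)\<^sup>2 + (\<Sum>i<n. (\<epsilon> n \<omega> $ i)\<^sup>2) / real n)"
      if "\<omega> \<in> space (M n)" for \<omega>
      using eps_dim[OF n that]
      by (simp add: W_def scalar_prod_def atLeast0LessThan power2_eq_square)
    have int1: "integrable (M n) (\<lambda>\<omega>. (\<Sum>i<n. w n $ i * \<epsilon> n \<omega> $ i)\<^sup>2)"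
      and exp1: "expectation (\<lambda>\<omega>. (\<Sum>i<n. w n $ i * \<epsilon> n \<omega> $ i)\<^sup>2) =
        (\<Sum>i<n. (w n $ i)\<^sup>2 * variance (\<lambda>\<omega>. \<epsilon> n \<omega> $ i))"
      using integrable_weighted_sum_square[of "{..<n}" "\<lambda>i \<omega>. \<epsilon> n \<omega> $ i" "vec_index (w n)"]
        expectation_weighted_sum_square[of "{..<n}" "\<lambda>i \<omega>. \<epsilon> n \<omega> $ i" "vec_index (w n)"]
        eps_indep[OF n] eps_integrable[OF n] eps_mean[OF n] eps_sq_integrable[OF n] by auto
    note exp1
    also have "(\<Sum>i<n. (w n $ i)\<^sup>2 * variance (\<lambda>\<omega>. \<epsilon> n \<omega> $ i)) \<le> (\<Sum>i<n. (w n $ i)\<^sup>2 * \<sigma>\<^sup>2)"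
      using eps_variance[OF n] by (intro sum_mono mult_left_mono) auto
    also have "\<dots> = (\<Sum>i<n. (w n $ i)\<^sup>2) * \<sigma>\<^sup>2"
      by (simp add: sum_distrib_right)
    also have "(\<Sum>i<n. (w n $ i)\<^sup>2) = w n \<bullet> w n"
      using w[OF n] by (auto simp: scalar_prod_def atLeast0LessThan power2_eq_square)
    also have "w n \<bullet> w n = 1"
      using w[OF n] by blast
    finally have le1: "expectation (\<lambda>\<omega>. (\<Sum>i<n. w n $ i * \<epsilon> n \<omega> $ i)\<^sup>2) \<le> \<sigma>\<^sup>2"
      by simp
    have int2: "integrable (M n) (\<lambda>\<omega>. (\<Sum>i<n. (\<epsilon> n \<omega> $ i)\<^sup>2) / real n)"
      using eps_sq_integrable[OF n] by (intro integrable_divide Bochner_Integration.integrable_sum) auto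
    have "expectation (\<lambda>\<omega>. (\<Sum>i<n. (\<epsilon> n \<omega> $ i)\<^sup>2) / real n) =
        (\<Sum>i<n. expectation (\<lambda>\<omega>. (\<epsilon> n \<omega> $ i)\<^sup>2)) / real n"
      using eps_sq_integrable[OF n] by (simp add: Bochner_Integration.integral_sum)
    also have "\<dots> \<le> (\<Sum>i<n. \<sigma>\<^sup>2) / real n"
      using eps_variance[OF n] eps_mean[OF n] by (intro divide_right_mono sum_mono) auto
    also have "\<dots> = \<sigma>\<^sup>2" using n by simp
    finally have le2: "expectation (\<lambda>\<omega>. (\<Sum>i<n. (\<epsilon> n \<omega> $ i)\<^sup>2) / real n) \<le> \<sigma>\<^sup>2" .
    let ?W = "\<lambda>\<omega>. 2 * ((\<Sum>i<n. w n $ i * \<epsilon> n \<omega> $ i)\<^sup>2 + (\<Sum>i<n. (\<epsilon> n \<omega> $ i)\<^sup>2) / real n)"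
    have "integrable (M n) ?W"
      using int1 int2 by (intro integrable_mult_right Bochner_Integration.integrable_add)
    then have "integrable (M n) (W n)"
      using W_eq by (subst Bochner_Integration.integrable_cong[OF refl]) auto
    moreover have "integral\<^sup>L (M n) (W n) = expectation ?W"
      using W_eq by (intro Bochner_Integration.integral_cong) auto
    moreover have "expectation ?W \<le> 4 * \<sigma>\<^sup>2"
      using int1 int2 le1 le2 by (subst integral_mult_right_zero) (subst Bochner_Integration.integral_add; simp)
    ultimately show ?thesis by simp
  qed
  have "bigO_P M
      (\<lambda>n \<omega>. min_over (nonneg_orthant (p n)) (nnls_objective (X n) (\<epsilon> n \<omega>))
             - min_over (nonneg_orthant (p n))
                 (\<lambda>\<beta>. nnls_objective ((Pm n * X n) * Dm n) (\<epsilon> n \<omega>) \<beta>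
                       + \<tau>\<^sup>2 * (ones_vec (p n) \<bullet> \<beta>)\<^sup>2))
      (\<lambda>n. 1 / sqrt (real n))"
  proof (rule bigO_P_of_expectation_le[OF M_prob])
    fix n :: nat and \<omega> assume n: "n \<ge> 1" and \<omega>: "\<omega> \<in> space (M n)"
    interpret self_regularizing_design n "p n" "X n" "w n" \<tau>
      using n by (rule design)
    show "\<bar>min_over (nonneg_orthant (p n)) (nnls_objective (X n) (\<epsilon> n \<omega>))
             - min_over (nonneg_orthant (p n))
                 (\<lambda>\<beta>. nnls_objective ((Pm n * X n) * Dm n) (\<epsilon> n \<omega>) \<beta>
                       + \<tau>\<^sup>2 * (ones_vec (p n) \<bullet> \<beta>)\<^sup>2)\<bar> \<le> W n \<omega> * (1 / sqrt (real n))"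
      using abs_min_diff_le[OF eps_dim[OF n \<omega>]]
      unfolding regularized_objective_def Pm_def Dm_def W_def .
    show "0 \<le> W n \<omega>"
      by (simp add: W_def scalar_prod_self_nonneg)
  qed (use W in auto)
  moreover have "smallo_P M (\<lambda>n \<omega>. (1 / real n) * (l2_norm (X n *\<^sub>v \<beta>hat n \<omega>))\<^sup>2) (\<lambda>_. 1)"
    if small: "smallo_P M (\<lambda>n \<omega>. (1 / real n) * linf_norm (transpose_mat (X n) *\<^sub>v \<epsilon> n \<omega>)) (\<lambda>_. 1)"
      and min: "\<forall>n\<ge>1. \<forall>\<omega>\<in>space (M n). is_arg_min (nnls_objective (X n) (\<epsilon> n \<omega>))
        (\<lambda>\<beta>. \<beta> \<in> nonneg_orthant (p n)) (\<beta>hat n \<omega>)" for \<beta>hat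
  proof (rule smallo_P_of_le_square[OF small, of "2 / \<tau>"])
    fix n :: nat and \<omega> assume n: "n \<ge> 1" and \<omega>: "\<omega> \<in> space (M n)"
    interpret self_regularizing_design n "p n" "X n" "w n" \<tau>
      using n by (rule design)
    have "\<beta>hat n \<omega> \<in> nonneg_orthant (p n)"
      "nnls_objective (X n) (\<epsilon> n \<omega>) (\<beta>hat n \<omega>) \<le> nnls_objective (X n) (\<epsilon> n \<omega>) (0\<^sub>v (p n))"
      using min n \<omega> zero_in_nonneg_orthant by (auto simp: is_arg_min_linorder)
    from prediction_error_le[OF eps_dim[OF n \<omega>] this]
    show "\<bar>(1 / real n) * (l2_norm (X n *\<^sub>v \<beta>hat n \<omega>))\<^sup>2\<bar>
        \<le> ((2 / \<tau>) * ((1 / real n) * linf_norm (transpose_mat (X n) *\<^sub>v \<epsilon> n \<omega>)))\<^sup>2"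
      by simp
  qed (use \<tau> in simp)
  ultimately show ?thesis
    using matrices by blast
qed

end
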